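(* Let $(\mathcal{A},\mathcal{B})=\{(A_i,B_i)\}_{i=1}^m$ be a 1-cross intersecting set pair system of size $m$, and let $V:=\bigcup_{i=1}^m A_i$. Then the characteristic vectors of the edges $A_1,\dots,A_m$ of $\mathcal{A}$ are linearly independent in $\mathbb{R}^V$.
   Context: A cross intersecting set pair system (SPS) of size $m\ge 2$ consists of finite sets $A_1,\dots,A_m$ and $B_1,\dots,B_m$ such that $A_i\cap B_i=\emptyset$ for every $1\le i\le m$ and $A_i\cap B_j\neq\emptyset$ for all $1\le i\neq j\le m$; one writes $\mathcal{A}=\{A_i\}_{i=1}^m$, $\mathcal{B}=\{B_i\}_{i=1}^m$. It is 1-cross intersecting if $|A_i\cap B_j|=1$ for each $i\neq j$. The characteristic vector of $A_i$ is the vector in $\mathbb{R}^V$ whose coordinate at $v\in V$ is $1$ if $v\in A_i$ and $0$ otherwise. *)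

theory Defs
  imports Complex_Main "HOL-Library.Function_Algebras" "HOL-Library.Indicator_Function"
begin

definition cross_intersecting_sps :: "nat \<Rightarrow> (nat \<Rightarrow> 'a set) \<Rightarrow> (nat \<Rightarrow> 'a set) \<Rightarrow> bool" where
  "cross_intersecting_sps m A B \<longleftrightarrow>
     m \<ge> 2 \<and>
     (\<forall>i\<in>{1..m}. finite (A i) \<and> finite (B i)) \<and>
     (\<forall>i\<in>{1..m}. A i \<inter> B i = {}) \<and>
     (\<forall>i\<in>{1..m}. \<forall>j\<in>{1..m}. i \<noteq> j \<longrightarrow> A i \<inter> B j \<noteq> {})"

definition one_cross_intersecting_sps :: "nat \<Rightarrow> (nat \<Rightarrow> 'a set) \<Rightarrow> (nat \<Rightarrow> 'a set) \<Rightarrow> bool" where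
  "one_cross_intersecting_sps m A B \<longleftrightarrow>
     cross_intersecting_sps m A B \<and>
     (\<forall>i\<in>{1..m}. \<forall>j\<in>{1..m}. i \<noteq> j \<longrightarrow> card (A i \<inter> B j) = 1)"

text \<open>Addition and zero on functions are the pointwise ones of Function_Algebras; with the
  pointwise scalar multiplication below, subspace and independent become available for
  functions.\<close>

instantiation "fun" :: (type, real_vector) real_vector
begin

definition scaleR_fun :: "real \<Rightarrow> ('a \<Rightarrow> 'b) \<Rightarrow> 'a \<Rightarrow> 'b" where
  "scaleR_fun c f = (\<lambda>x. c *\<^sub>R f x)"

instance
  by standard (simp_all add: scaleR_fun_def fun_eq_iff scaleR_add_left scaleR_add_right)

end

text \<open>The space $\mathbb{R}^V$ for a subset V of the ambient type, realised as the functions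
  vanishing outside V. It is a linear subspace, so independence in it is the same as
  independence among all functions.\<close>

definition coord_space :: "'a set \<Rightarrow> ('a \<Rightarrow> real) set" where
  "coord_space V = {x. \<forall>v. v \<notin> V \<longrightarrow> x v = 0}"

lemma subspace_coord_space: "subspace (coord_space V)"
  by (auto simp: subspace_def coord_space_def scaleR_fun_def)

definition char_vec :: "'a set \<Rightarrow> 'a \<Rightarrow> real" where
  "char_vec S = indicator S"

end

theory Submission
  imports Defs
begin

text \<open>Summing a function over \<open>B j\<close> is a linear functional, and it sends the characteristic vector
  of \<open>A i\<close> to the cardinality of \<open>A i \<inter> B j\<close>. The matrix of these values is \<open>J - I\<close>, with
  zeros on the diagonal and ones elsewhere. It is invertible for size \<open>m \<ge> 2\<close>, since \<open>J\<close> has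
  only the eigenvalues \<open>0\<close> and \<open>m\<close>; a nontrivial linear relation among the characteristic vectors
  would be a nontrivial relation among the rows of this matrix. The invertibility is the content
  of \<open>offdiagonal_sums_zero_imp_zero\<close>.\<close>

text \<open>Every \<open>c j\<close> equals the total \<open>s\<close> of all coefficients; adding these equations up gives
  \<open>s = card I * s\<close>, hence \<open>s = 0\<close>.\<close>

lemma offdiagonal_sums_zero_imp_zero:
  fixes c :: "'i \<Rightarrow> real"
  assumes "finite I" and "card I \<noteq> 1"
    and off: "\<And>j. j \<in> I \<Longrightarrow> (\<Sum>i\<in>I - {j}. c i) = 0"
    and "k \<in> I"
  shows "c k = 0"
proof -
  define s where "s = (\<Sum>i\<in>I. c i)"
  have c_eq: "c j = s" if "j \<in> I" for j
    using off[OF that] sum.remove[OF \<open>finite I\<close> that, of c] by (simp add: s_def)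
  have "s = real (card I) * s"
    using c_eq by (subst s_def) simp
  with \<open>card I \<noteq> 1\<close> have "s = 0"
    by simp
  with c_eq[OF \<open>k \<in> I\<close>] show ?thesis
    by simp
qed

lemma sum_char_vec:
  assumes "finite T"
  shows "(\<Sum>x\<in>T. char_vec S x) = real (card (S \<inter> T))"
  using assms by (simp add: char_vec_def indicator_def sum.If_cases Int_commute)

lemma sum_fun_apply: "(\<Sum>i\<in>I. f i) x = (\<Sum>i\<in>I. f i x)"
  for f :: "'i \<Rightarrow> 'a \<Rightarrow> real"
  by (induction I rule: infinite_finite_induct) auto

text \<open>Summing the relation over \<open>B j\<close> erases the \<open>j\<close>-th term, because \<open>A j\<close> misses \<open>B j\<close>, and turns
  every other term into its bare coefficient, because the other sets meet \<open>B j\<close> exactly once.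
  The coefficients are indexed by \<open>I\<close> rather than by vectors, so that repeated vectors would also
  count as a nontrivial relation.\<close>

lemma char_vec_relation_trivial:
  fixes A B :: "'i \<Rightarrow> 'a set"
  assumes "finite I" and "card I \<noteq> 1"
    and fin: "\<And>j. j \<in> I \<Longrightarrow> finite (B j)"
    and diag: "\<And>j. j \<in> I \<Longrightarrow> A j \<inter> B j = {}"
    and off: "\<And>i j. i \<in> I \<Longrightarrow> j \<in> I \<Longrightarrow> i \<noteq> j \<Longrightarrow> card (A i \<inter> B j) = 1"
    and rel: "(\<Sum>i\<in>I. c i *\<^sub>R char_vec (A i)) = 0"
    and "k \<in> I"
  shows "c k = 0"
proof (rule offdiagonal_sums_zero_imp_zero[OF \<open>finite I\<close> \<open>card I \<noteq> 1\<close> _ \<open>k \<in> I\<close>])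
  fix j assume j: "j \<in> I"
  have pointwise: "(\<Sum>i\<in>I. c i * char_vec (A i) x) = 0" for x
    using fun_cong[OF rel, of x] by (simp add: sum_fun_apply scaleR_fun_def)
  have "(\<Sum>i\<in>I - {j}. c i) = (\<Sum>i\<in>I - {j}. c i * real (card (A i \<inter> B j)))"
    using off j by (intro sum.cong) auto
  also have "\<dots> = (\<Sum>i\<in>I. c i * real (card (A i \<inter> B j)))"
    using sum.remove[OF \<open>finite I\<close> j, of "\<lambda>i. c i * real (card (A i \<inter> B j))"] diag[OF j]
    by simp
  also have "\<dots> = (\<Sum>i\<in>I. \<Sum>x\<in>B j. c i * char_vec (A i) x)"
    by (simp add: sum_char_vec[OF fin[OF j], symmetric] sum_distrib_left)
  also have "\<dots> = (\<Sum>x\<in>B j. \<Sum>i\<in>I. c i * char_vec (A i) x)"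
    by (rule sum.swap)
  also have "\<dots> = 0"
    by (simp add: pointwise)
  finally show "(\<Sum>i\<in>I - {j}. c i) = 0" .
qed

theorem proposition1p3:
  fixes A B :: "nat \<Rightarrow> 'a set" and m :: nat and V :: "'a set"
  assumes "one_cross_intersecting_sps m A B"
    and "V = (\<Union>i\<in>{1..m}. A i)"
  shows "(\<forall>i\<in>{1..m}. char_vec (A i) \<in> coord_space V) \<and>
         inj_on (\<lambda>i. char_vec (A i)) {1..m} \<and>
         independent ((\<lambda>i. char_vec (A i)) ` {1..m})"
proof (intro conjI)
  have m: "card {1..m} \<noteq> 1"
    and fin: "\<And>j. j \<in> {1..m} \<Longrightarrow> finite (B j)"
    and diag: "\<And>j. j \<in> {1..m} \<Longrightarrow> A j \<inter> B j = {}"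
    and off: "\<And>i j. i \<in> {1..m} \<Longrightarrow> j \<in> {1..m} \<Longrightarrow> i \<noteq> j \<Longrightarrow> card (A i \<inter> B j) = 1"
    using assms(1) unfolding one_cross_intersecting_sps_def cross_intersecting_sps_def by auto
  show "\<forall>i\<in>{1..m}. char_vec (A i) \<in> coord_space V"
    using assms(2) by (auto simp: coord_space_def char_vec_def indicator_def)
  show inj: "inj_on (\<lambda>i. char_vec (A i)) {1..m}"
  proof (rule inj_onI, rule ccontr)
    fix i j assume ij: "i \<in> {1..m}" "j \<in> {1..m}" "char_vec (A i) = char_vec (A j)" "i \<noteq> j"
    \<comment> \<open>Equal sets would have to meet \<open>B j\<close> in both zero and one points.\<close>
    then have "A i = A j"
      by (simp add: char_vec_def indicator_def fun_eq_iff of_bool_eq_iff set_eq_iff)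
    with diag[OF ij(2)] off[OF ij(1,2,4)] show False
      by simp
  qed
  show "independent ((\<lambda>i. char_vec (A i)) ` {1..m})"
  proof (rule independent_if_scalars_zero)
    fix u :: "('a \<Rightarrow> real) \<Rightarrow> real" and v
    assume rel: "(\<Sum>x\<in>(\<lambda>i. char_vec (A i)) ` {1..m}. u x *\<^sub>R x) = 0"
      and "v \<in> (\<lambda>i. char_vec (A i)) ` {1..m}"
    then obtain k where k: "k \<in> {1..m}" "v = char_vec (A k)"
      by blast
    have "(\<Sum>i\<in>{1..m}. u (char_vec (A i)) *\<^sub>R char_vec (A i)) = 0"
      using rel unfolding sum.reindex[OF inj] comp_def .
    from char_vec_relation_trivial[OF _ m fin diag off this k(1)] k(2) show "u v = 0"
      by simp
  qed simp
qed

end
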